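(* Let $(\mathbb{X},\mathfrak{d})$ be a compact metric space, $d\in\mathbb{N}$, and let $\xi=(\xi(x))_{x\in\mathbb{X}}$ be a $d$-variate Gaussian process with continuous sample paths. Then its mean function $m:\mathbb{X}\to\mathbb{R}^d$ and its matrix covariance function $k:\mathbb{X}\times\mathbb{X}\to\mathbb{R}^{d\times d}$ are continuous.
   Context: A $d$-variate Gaussian process is an $\mathbb{R}^d$-valued process whose finite-dimensional distributions are (possibly degenerate) Gaussian; $m(x)=\mathbb{E}[\xi(x)]$ and $k(x,y)=\mathbb{E}[(\xi(x)-m(x))(\xi(y)-m(y))^\top]$. *)

theory Defs
  imports "HOL-Probability.Probability"
begin

text \<open>One-dimensional Gaussian laws. The case \<open>\<sigma> = 0\<close> is the Dirac measure at \<open>\<mu>\<close>.\<close>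

definition gaussian_real :: "real measure \<Rightarrow> bool" where
  "gaussian_real N \<longleftrightarrow>
     (\<exists>\<mu> \<sigma>. (\<sigma> = 0 \<and> N = return borel \<mu>) \<or>
            (\<sigma> > 0 \<and> N = density lborel (normal_density \<mu> \<sigma>)))"

text \<open>
  Possibly degenerate Gaussian laws on the finite product \<open>(real ^ 'd) ^ I\<close>, with \<open>I\<close> a finite
  index set: every linear functional has a (possibly degenerate) one-dimensional Gaussian law.
  The linear functionals on this space are exactly the maps \<open>y \<mapsto> \<Sum>i\<in>I. u i \<bullet> y i\<close>.
\<close>

definition gaussian_PiM :: "'i set \<Rightarrow> ('i \<Rightarrow> real ^ 'd) measure \<Rightarrow> bool" where
  "gaussian_PiM I N \<longleftrightarrow>
     sets N = sets (\<Pi>\<^sub>M i\<in>I. (borel :: (real ^ 'd) measure)) \<and>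
     (\<forall>u :: 'i \<Rightarrow> real ^ 'd. gaussian_real (distr N borel (\<lambda>y. \<Sum>i\<in>I. u i \<bullet> y i)))"

definition fin_dim_distr ::
  "'w measure \<Rightarrow> ('x \<Rightarrow> 'w \<Rightarrow> real ^ 'd) \<Rightarrow> 'x set \<Rightarrow> ('x \<Rightarrow> real ^ 'd) measure" where
  "fin_dim_distr M \<xi> I = distr M (\<Pi>\<^sub>M x\<in>I. borel) (\<lambda>\<omega>. \<lambda>x\<in>I. \<xi> x \<omega>)"

definition gaussian_process ::
  "'w measure \<Rightarrow> 'x set \<Rightarrow> ('x \<Rightarrow> 'w \<Rightarrow> real ^ 'd) \<Rightarrow> bool" where
  "gaussian_process M X \<xi> \<longleftrightarrow>
     prob_space M \<and>
     (\<forall>x\<in>X. \<xi> x \<in> borel_measurable M) \<and>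
     (\<forall>I. finite I \<and> I \<subseteq> X \<longrightarrow> gaussian_PiM I (fin_dim_distr M \<xi> I))"

definition outer_prod :: "real ^ 'd \<Rightarrow> real ^ 'd \<Rightarrow> real ^ 'd ^ 'd" where
  "outer_prod v w = (\<chi> i j. v $ i * w $ j)"

definition mean_fun :: "'w measure \<Rightarrow> ('x \<Rightarrow> 'w \<Rightarrow> real ^ 'd) \<Rightarrow> 'x \<Rightarrow> real ^ 'd" where
  "mean_fun M \<xi> x = (\<integral>\<omega>. \<xi> x \<omega> \<partial>M)"

definition cov_fun ::
  "'w measure \<Rightarrow> ('x \<Rightarrow> 'w \<Rightarrow> real ^ 'd) \<Rightarrow> 'x \<Rightarrow> 'x \<Rightarrow> real ^ 'd ^ 'd" where
  "cov_fun M \<xi> x y =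
     (\<integral>\<omega>. outer_prod (\<xi> x \<omega> - mean_fun M \<xi> x) (\<xi> y \<omega> - mean_fun M \<xi> y) \<partial>M)"

end

theory Submission
  imports Defs
begin

text \<open>
  If points \<open>s n\<close> converge to \<open>x\<close>, then \<open>\<xi> (s n) - \<xi> x\<close> tends to \<open>0\<close> at every outcome, and each of
  its components is a real Gaussian variable. For general variables this would say nothing about
  moments, but a Gaussian law cannot hide its size in small probabilities: if \<open>Z\<close> has mean \<open>\<mu>\<close> and
  standard deviation \<open>\<sigma>\<close>, then \<open>\<bar>Z\<bar> \<ge> \<bar>\<mu>\<bar> + \<sigma>\<close> holds with a probability at least \<open>c > 0\<close>, where
  \<open>c\<close> is a universal constant. So convergence in probability to \<open>0\<close> forces \<open>\<bar>\<mu>\<bar> + \<sigma>\<close>, and with it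
  the second moment \<open>\<mu>\<^sup>2 + \<sigma>\<^sup>2\<close>, to tend to \<open>0\<close>
  (\<open>gaussian_real_second_moment_tail\<close>, \<open>gaussian_real_second_moment_tendsto_zero\<close>).

  Hence \<open>x \<mapsto> \<xi> x\<close> is continuous into \<open>L\<^sup>2\<close> (\<open>gaussian_process_L2_continuous\<close>). The rest holds for every
  \<open>L\<^sup>2\<close>-continuous process: the expectation is \<open>L\<^sup>2\<close>-continuous, so the mean is continuous and centring
  preserves \<open>L\<^sup>2\<close> convergence (\<open>centred_tendsto_L2\<close>); and the covariance is the integral of a
  bounded bilinear map, the outer product, of two \<open>L\<^sup>2\<close>-continuous factors, which by Cauchy--Schwarz
  is continuous in both factors jointly (\<open>integral_bilinear_tendsto_L2\<close>).
\<close>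

section \<open>Size and tails of one-dimensional Gaussian laws\<close>

abbreviation std_normal :: "real measure" where
  "std_normal \<equiv> density lborel (\<lambda>x. ennreal (std_normal_density x))"

text \<open>
  Degenerate and nondegenerate Gaussian laws become one case: both are images of the standard normal
  law under \<open>w \<mapsto> \<mu> + \<sigma> * w\<close>, with \<open>\<sigma> = 0\<close> giving the Dirac measures.
\<close>

lemma gaussian_real_affine_std_normal:
  assumes "gaussian_real N"
  obtains \<mu> \<sigma> where "\<sigma> \<ge> 0" "N = distr std_normal borel (\<lambda>w. \<mu> + \<sigma> * w)"
proof -
  interpret S: prob_space std_normal by (rule prob_space_normal_density) simp
  from assms obtain \<mu> \<sigma> where
    "(\<sigma> = 0 \<and> N = return borel \<mu>) \<or> (\<sigma> > 0 \<and> N = density lborel (normal_density \<mu> \<sigma>))"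
    unfolding gaussian_real_def by blast
  then show ?thesis
  proof (elim disjE conjE)
    assume "\<sigma> = 0" "N = return borel \<mu>"
    then show ?thesis
      by (intro that[of 0 \<mu>]) (simp_all add: S.distr_const)
  next
    assume \<sigma>: "\<sigma> > 0" and N: "N = density lborel (normal_density \<mu> \<sigma>)"
    have "distributed std_normal lborel (\<lambda>w. w) (normal_density 0 1)"
      unfolding distributed_def by (auto intro!: distr_id2)
    from S.normal_density_affine[OF this, of \<sigma> \<mu>] \<sigma>
    have "distr std_normal lborel (\<lambda>w. \<mu> + \<sigma> * w) = N"
      by (simp add: N distributed_def)
    moreover have "distr std_normal lborel (\<lambda>w. \<mu> + \<sigma> * w) = distr std_normal borel (\<lambda>w. \<mu> + \<sigma> * w)"
      by (rule distr_cong) auto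
    ultimately show ?thesis
      using \<sigma> by (intro that[of \<sigma> \<mu>]) auto
  qed
qed

lemma std_normal_interval_pos:
  assumes "a < b"
  shows "measure std_normal {a..b} > 0"
proof -
  interpret S: prob_space std_normal by (rule prob_space_normal_density) simp
  have pos: "\<not> std_normal_density x \<le> 0" for x
    using normal_density_pos[of 1 0 x] by (simp only: not_le zero_less_one)
  have "emeasure std_normal {a..b} \<noteq> 0"
  proof
    assume "emeasure std_normal {a..b} = 0"
    then have "{a..b} \<in> null_sets std_normal" by auto
    then have "AE x in lborel. x \<in> {a..b} \<longrightarrow> ennreal (std_normal_density x) = 0"
      by (subst (asm) null_sets_density_iff) auto
    then have "AE x in lborel. x \<notin> {a..b}"
      by eventually_elim (simp only: ennreal_eq_0_iff pos simp_thms)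
    then have "emeasure lborel {a..b} = 0"
      by (subst (asm) AE_iff_measurable[of "{a..b}"]) auto
    with assms show False by simp
  qed
  then show ?thesis
    by (simp add: S.emeasure_eq_measure zero_less_measure_iff)
qed

lemma std_normal_moments:
  shows "integrable std_normal (\<lambda>w. w)" "integrable std_normal (\<lambda>w. w\<^sup>2)"
    "(\<integral>w. w \<partial>std_normal) = 0" "(\<integral>w. w\<^sup>2 \<partial>std_normal) = 1"
  using integrable_std_normal_moment[of 1] integrable_std_normal_moment[of 2]
    integral_std_normal_moment_odd[of 0] integral_std_normal_moment_even[of 1]
  by (simp_all add: integrable_density integral_density)

text \<open>
  The radius is \<open>r = \<bar>\<mu>\<bar> + \<sigma>\<close>. Writing the variable as \<open>\<mu> + \<sigma> * w\<close>, its absolute value is at least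
  \<open>r\<close> as soon as \<open>w \<ge> 1\<close> (if \<open>\<mu> \<ge> 0\<close>) or \<open>w \<le> -1\<close> (if \<open>\<mu> < 0\<close>), because the random part then pushes
  away from \<open>0\<close> in the same direction as the mean. Both events have a fixed positive standard normal
  probability, and \<open>\<mu>\<^sup>2 + \<sigma>\<^sup>2 \<le> r\<^sup>2\<close>. The order of the quantifiers is what matters: \<open>c\<close> does not depend
  on the law.
\<close>

lemma gaussian_real_second_moment_tail:
  obtains c where "c > 0"
    "\<And>N. gaussian_real N \<Longrightarrow>
      \<exists>r\<ge>0. c \<le> measure N {z. r \<le> \<bar>z\<bar>} \<and> integrable N (\<lambda>z. z\<^sup>2) \<and> (\<integral>z. z\<^sup>2 \<partial>N) \<le> r\<^sup>2"
proof -
  interpret S: prob_space std_normal by (rule prob_space_normal_density) simp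
  define c where "c = min (measure std_normal {1..2}) (measure std_normal {-2..-1})"
  have "c > 0" using std_normal_interval_pos by (simp add: c_def)
  moreover have "\<exists>r\<ge>0. c \<le> measure N {z. r \<le> \<bar>z\<bar>} \<and> integrable N (\<lambda>z. z\<^sup>2) \<and> (\<integral>z. z\<^sup>2 \<partial>N) \<le> r\<^sup>2"
    if gauss: "gaussian_real N" for N
  proof -
    obtain \<mu> \<sigma> where \<sigma>: "\<sigma> \<ge> 0" and N: "N = distr std_normal borel (\<lambda>w. \<mu> + \<sigma> * w)"
      using gaussian_real_affine_std_normal[OF gauss] .
    define r where "r = \<bar>\<mu>\<bar> + \<sigma>"
    have meas: "measure N {z. r \<le> \<bar>z\<bar>} = measure std_normal {w. r \<le> \<bar>\<mu> + \<sigma> * w\<bar>}"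
      unfolding N by (subst measure_distr) (auto simp: vimage_def)
    have "c \<le> measure N {z. r \<le> \<bar>z\<bar>}"
    proof (cases "\<mu> \<ge> 0")
      case True
      have "r \<le> \<bar>\<mu> + \<sigma> * w\<bar>" if "1 \<le> w" for w
        using mult_left_mono[OF that \<sigma>] True by (simp add: r_def)
      then have "measure std_normal {1..2} \<le> measure std_normal {w. r \<le> \<bar>\<mu> + \<sigma> * w\<bar>}"
        by (intro S.finite_measure_mono) auto
      then show ?thesis unfolding meas c_def by simp
    next
      case False
      have "r \<le> \<bar>\<mu> + \<sigma> * w\<bar>" if "w \<le> -1" for w
        using mult_left_mono[OF that \<sigma>] False by (simp add: r_def)
      then have "measure std_normal {-2..-1} \<le> measure std_normal {w. r \<le> \<bar>\<mu> + \<sigma> * w\<bar>}"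
        by (intro S.finite_measure_mono) auto
      then show ?thesis unfolding meas c_def by simp
    qed
    moreover have sq: "(\<mu> + \<sigma> * w)\<^sup>2 = \<mu>\<^sup>2 + 2 * \<mu> * \<sigma> * w + \<sigma>\<^sup>2 * w\<^sup>2" for w
      by (simp add: power2_eq_square algebra_simps)
    have "integrable N (\<lambda>z. z\<^sup>2)"
      unfolding N by (subst integrable_distr_eq) (auto simp: sq std_normal_moments)
    moreover have "S.prob UNIV = 1"
      using S.prob_space by simp
    then have "(\<integral>z. z\<^sup>2 \<partial>N) = \<mu>\<^sup>2 + \<sigma>\<^sup>2"
      unfolding N by (subst integral_distr) (auto simp: sq std_normal_moments)
    moreover have "\<mu>\<^sup>2 + \<sigma>\<^sup>2 \<le> r\<^sup>2" "r \<ge> 0"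
      using \<sigma> by (auto simp: r_def power2_sum)
    ultimately show ?thesis by auto
  qed
  ultimately show ?thesis by (rule that)
qed

text \<open>
  Pointwise convergence makes \<open>\<bar>Z n\<bar> \<ge> \<delta>\<close> less likely than the universal constant \<open>c\<close> for large \<open>n\<close>.
  The radius at which the tail of \<open>Z n\<close> still has mass \<open>c\<close> must then be below \<open>\<delta>\<close>, and
  its square bounds the second moment.
\<close>

lemma gaussian_real_second_moment_tendsto_zero:
  assumes "prob_space M"
    and [measurable]: "\<And>n. Z n \<in> borel_measurable M"
    and gauss: "\<And>n. gaussian_real (distr M borel (Z n))"
    and lim: "\<And>\<omega>. \<omega> \<in> space M \<Longrightarrow> (\<lambda>n. Z n \<omega>) \<longlonglongrightarrow> 0"
  shows "(\<lambda>n. \<integral>\<omega>. (Z n \<omega>)\<^sup>2 \<partial>M) \<longlonglongrightarrow> (0::real)"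
proof -
  interpret prob_space M by fact
  obtain c where c: "c > 0" and tail: "\<And>N. gaussian_real N \<Longrightarrow>
      \<exists>r\<ge>0. c \<le> measure N {z. r \<le> \<bar>z\<bar>} \<and> integrable N (\<lambda>z. z\<^sup>2) \<and> (\<integral>z. z\<^sup>2 \<partial>N) \<le> r\<^sup>2"
    using gaussian_real_second_moment_tail by blast
  show ?thesis
  proof (rule LIMSEQ_I)
    fix e :: real assume e: "e > 0"
    define \<delta> where "\<delta> = sqrt e"
    have \<delta>: "\<delta> > 0" using e by (simp add: \<delta>_def)
    have "(\<lambda>n. \<integral>\<omega>. indicator {\<omega> \<in> space M. \<delta> \<le> \<bar>Z n \<omega>\<bar>} \<omega> \<partial>M) \<longlonglongrightarrow> (\<integral>\<omega>. 0 \<partial>M :: real)"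
    proof (rule integral_dominated_convergence[where w = "\<lambda>_. 1"])
      show "AE \<omega> in M. (\<lambda>n. indicator {\<omega> \<in> space M. \<delta> \<le> \<bar>Z n \<omega>\<bar>} \<omega>) \<longlonglongrightarrow> (0::real)"
      proof (rule AE_I2)
        fix \<omega> assume "\<omega> \<in> space M"
        from LIMSEQ_D[OF lim[OF this] \<delta>]
        have "eventually (\<lambda>n. \<bar>Z n \<omega>\<bar> < \<delta>) sequentially"
          by (auto simp: eventually_sequentially)
        then have "eventually (\<lambda>n. indicator {\<omega> \<in> space M. \<delta> \<le> \<bar>Z n \<omega>\<bar>} \<omega> = (0::real)) sequentially"
          by eventually_elim auto
        then show "(\<lambda>n. indicator {\<omega> \<in> space M. \<delta> \<le> \<bar>Z n \<omega>\<bar>} \<omega>) \<longlonglongrightarrow> (0::real)"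
          by (rule tendsto_eventually)
      qed
    qed auto
    then have "(\<lambda>n. prob {\<omega> \<in> space M. \<delta> \<le> \<bar>Z n \<omega>\<bar>}) \<longlonglongrightarrow> 0"
      by simp
    then obtain n0 where n0: "\<And>n. n \<ge> n0 \<Longrightarrow> prob {\<omega> \<in> space M. \<delta> \<le> \<bar>Z n \<omega>\<bar>} < c"
      using c by (force dest: LIMSEQ_D)
    have "(\<integral>\<omega>. (Z n \<omega>)\<^sup>2 \<partial>M) < e" if "n \<ge> n0" for n
    proof -
      obtain r where r: "r \<ge> 0" "c \<le> measure (distr M borel (Z n)) {z. r \<le> \<bar>z\<bar>}"
        "(\<integral>z. z\<^sup>2 \<partial>distr M borel (Z n)) \<le> r\<^sup>2"
        using tail[OF gauss[of n]] by blast
      have "measure (distr M borel (Z n)) {z. r \<le> \<bar>z\<bar>} = prob {\<omega> \<in> space M. r \<le> \<bar>Z n \<omega>\<bar>}"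
        by (subst measure_distr) (auto intro!: arg_cong[where f = prob])
      with r n0[OF that] have "prob {\<omega> \<in> space M. \<delta> \<le> \<bar>Z n \<omega>\<bar>} < prob {\<omega> \<in> space M. r \<le> \<bar>Z n \<omega>\<bar>}"
        by linarith
      moreover have "prob {\<omega> \<in> space M. r \<le> \<bar>Z n \<omega>\<bar>} \<le> prob {\<omega> \<in> space M. \<delta> \<le> \<bar>Z n \<omega>\<bar>}" if "\<delta> \<le> r"
        using that by (intro finite_measure_mono) auto
      ultimately have "r < \<delta>" by linarith
      then have "r\<^sup>2 < e" using r e
        by (metis \<delta>_def less_eq_real_def power_strict_mono real_sqrt_pow2 zero_less_numeral)
      moreover have "(\<integral>z. z\<^sup>2 \<partial>distr M borel (Z n)) = (\<integral>\<omega>. (Z n \<omega>)\<^sup>2 \<partial>M)"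
        by (rule integral_distr) auto
      ultimately show ?thesis using r by simp
    qed
    then show "\<exists>n0. \<forall>n\<ge>n0. norm ((\<integral>\<omega>. (Z n \<omega>)\<^sup>2 \<partial>M) - 0) < e"
      by (auto intro!: exI[of _ n0] simp: abs_of_nonneg)
  qed
qed

lemma gaussian_real_square_integrable:
  assumes "gaussian_real (distr M borel Z)" "Z \<in> borel_measurable M"
  shows "integrable M (\<lambda>\<omega>. (Z \<omega>)\<^sup>2)"
proof -
  have "integrable (distr M borel Z) (\<lambda>z. z\<^sup>2)"
    using gaussian_real_second_moment_tail assms(1) by metis
  then show ?thesis
    using assms(2) by (simp add: integrable_distr_eq)
qed


section \<open>Square-integrable vector-valued functions\<close>

lemma integral_Cauchy_Schwarz:
  fixes f :: "'a \<Rightarrow> 'b::real_normed_vector" and g :: "'a \<Rightarrow> 'c::real_normed_vector"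
  assumes [measurable]: "f \<in> borel_measurable M" "g \<in> borel_measurable M"
    and f: "integrable M (\<lambda>x. (norm (f x))\<^sup>2)" and g: "integrable M (\<lambda>x. (norm (g x))\<^sup>2)"
  shows "integrable M (\<lambda>x. norm (f x) * norm (g x))"
    and "(\<integral>x. norm (f x) * norm (g x) \<partial>M) \<le>
      sqrt ((\<integral>x. (norm (f x))\<^sup>2 \<partial>M) * (\<integral>x. (norm (g x))\<^sup>2 \<partial>M))"
proof -
  show int: "integrable M (\<lambda>x. norm (f x) * norm (g x))"
  proof (rule Bochner_Integration.integrable_bound)
    show "integrable M (\<lambda>x. (norm (f x))\<^sup>2 + (norm (g x))\<^sup>2)" using f g by simp
    have "norm a * norm b \<le> (norm a)\<^sup>2 + (norm b)\<^sup>2" for a :: 'b and b :: 'c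
      using sum_squares_bound[of "norm a" "norm b"] mult_nonneg_nonneg[of "norm a" "norm b"]
      by (simp add: mult.assoc del: mult_nonneg_nonneg)
    then show "AE x in M. norm (norm (f x) * norm (g x)) \<le> norm ((norm (f x))\<^sup>2 + (norm (g x))\<^sup>2)"
      by simp
  qed measurable
  have "(\<integral>\<^sup>+x. ennreal (norm (f x)) * ennreal (norm (g x)) \<partial>M)\<^sup>2
      \<le> (\<integral>\<^sup>+x. (ennreal (norm (f x)))\<^sup>2 \<partial>M) * (\<integral>\<^sup>+x. (ennreal (norm (g x)))\<^sup>2 \<partial>M)"
    by (rule Cauchy_Schwarz_nn_integral) measurable
  then have "ennreal ((\<integral>x. norm (f x) * norm (g x) \<partial>M)\<^sup>2)
      \<le> ennreal ((\<integral>x. (norm (f x))\<^sup>2 \<partial>M) * (\<integral>x. (norm (g x))\<^sup>2 \<partial>M))"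
    using f g int
    by (simp add: ennreal_mult[symmetric] ennreal_power nn_integral_eq_integral)
  then have "(\<integral>x. norm (f x) * norm (g x) \<partial>M)\<^sup>2 \<le> (\<integral>x. (norm (f x))\<^sup>2 \<partial>M) * (\<integral>x. (norm (g x))\<^sup>2 \<partial>M)"
    by (subst (asm) ennreal_le_iff) auto
  then show "(\<integral>x. norm (f x) * norm (g x) \<partial>M) \<le>
      sqrt ((\<integral>x. (norm (f x))\<^sup>2 \<partial>M) * (\<integral>x. (norm (g x))\<^sup>2 \<partial>M))"
    by (rule real_le_rsqrt)
qed

lemma norm_diff_square_le: "(norm (a - b))\<^sup>2 \<le> 2 * (norm a)\<^sup>2 + 2 * (norm b)\<^sup>2"
  for a b :: "'a::real_normed_vector"
proof -
  have "(norm (a - b))\<^sup>2 \<le> (norm a + norm b)\<^sup>2"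
    by (intro power_mono norm_triangle_ineq4) auto
  also have "\<dots> \<le> 2 * (norm a)\<^sup>2 + 2 * (norm b)\<^sup>2"
    using sum_squares_bound[of "norm a" "norm b"] by (simp add: power2_sum)
  finally show ?thesis .
qed

lemma integrable_norm_diff_square:
  fixes f g :: "'a \<Rightarrow> 'b::{real_normed_vector, second_countable_topology}"
  assumes [measurable]: "f \<in> borel_measurable M" "g \<in> borel_measurable M"
    and "integrable M (\<lambda>x. (norm (f x))\<^sup>2)" "integrable M (\<lambda>x. (norm (g x))\<^sup>2)"
  shows "integrable M (\<lambda>x. (norm (f x - g x))\<^sup>2)"
proof (rule Bochner_Integration.integrable_bound)
  show "integrable M (\<lambda>x. 2 * (norm (f x))\<^sup>2 + 2 * (norm (g x))\<^sup>2)" using assms by simp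
qed (auto simp: norm_diff_square_le)

text \<open>On a probability space this is Cauchy--Schwarz against the constant function \<open>1\<close>.\<close>

lemma (in prob_space) norm_expectation_square_le:
  fixes f :: "'a \<Rightarrow> 'b::{banach, second_countable_topology}"
  assumes [measurable]: "f \<in> borel_measurable M" and f: "integrable M (\<lambda>x. (norm (f x))\<^sup>2)"
  shows "integrable M f" and "norm (expectation f) \<le> sqrt (\<integral>x. (norm (f x))\<^sup>2 \<partial>M)"
proof -
  note CS = integral_Cauchy_Schwarz[OF assms(1) borel_measurable_const[of "1::real"] f]
  show int: "integrable M f"
    using CS(1) by (simp add: prob_space integrable_norm_iff)
  have "norm (expectation f) \<le> (\<integral>x. norm (f x) \<partial>M)"
    by (rule integral_norm_bound)
  also have "\<dots> \<le> sqrt (\<integral>x. (norm (f x))\<^sup>2 \<partial>M)"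
    using CS(2) by (simp add: prob_space)
  finally show "norm (expectation f) \<le> sqrt (\<integral>x. (norm (f x))\<^sup>2 \<partial>M)" .
qed

lemma integrable_bilinear_L2:
  fixes f :: "'w \<Rightarrow> 'a::{real_normed_vector, second_countable_topology}"
    and g :: "'w \<Rightarrow> 'b::{real_normed_vector, second_countable_topology}"
    and mul :: "'a \<Rightarrow> 'b \<Rightarrow> 'c::{banach, second_countable_topology}"
  assumes bil: "bounded_bilinear mul"
    and [measurable]: "f \<in> borel_measurable M" "g \<in> borel_measurable M"
    and fg: "integrable M (\<lambda>x. (norm (f x))\<^sup>2)" "integrable M (\<lambda>x. (norm (g x))\<^sup>2)"
  shows "integrable M (\<lambda>x. mul (f x) (g x))"
proof -
  obtain K where K: "\<And>a b. norm (mul a b) \<le> norm a * norm b * K"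
    using bounded_bilinear.bounded[OF bil] by blast
  have [measurable]: "(\<lambda>x. mul (f x) (g x)) \<in> borel_measurable M"
    by (rule borel_measurable_continuous_Pair)
      (auto intro!: bounded_bilinear.continuous_on[OF bil] continuous_intros)
  show ?thesis
  proof (rule Bochner_Integration.integrable_bound)
    show "integrable M (\<lambda>x. norm (f x) * norm (g x) * K)"
      using integral_Cauchy_Schwarz(1)[of f M g] fg by simp
    show "AE x in M. norm (mul (f x) (g x)) \<le> norm (norm (f x) * norm (g x) * K)"
      by (intro AE_I2 order_trans[OF K]) (simp only: real_norm_def abs_ge_self)
  qed measurable
qed

text \<open>
  With \<open>U = F n - f\<close> and \<open>V = G n - g\<close>, bilinearity gives
  \<open>mul (F n) (G n) - mul f g = mul U V + mul U g + mul f V\<close>. Every summand has a factor that tends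
  to \<open>0\<close> in \<open>L\<^sup>2\<close>, while the other one stays bounded there, so Cauchy--Schwarz applies.
\<close>

lemma integral_bilinear_tendsto_L2:
  fixes F :: "nat \<Rightarrow> 'w \<Rightarrow> 'a::{real_normed_vector, second_countable_topology}"
    and G :: "nat \<Rightarrow> 'w \<Rightarrow> 'b::{real_normed_vector, second_countable_topology}"
    and mul :: "'a \<Rightarrow> 'b \<Rightarrow> 'c::{banach, second_countable_topology}"
  assumes bil: "bounded_bilinear mul"
    and [measurable]: "\<And>n. F n \<in> borel_measurable M" "\<And>n. G n \<in> borel_measurable M"
      "f \<in> borel_measurable M" "g \<in> borel_measurable M"
    and F2: "\<And>n. integrable M (\<lambda>x. (norm (F n x))\<^sup>2)" and G2: "\<And>n. integrable M (\<lambda>x. (norm (G n x))\<^sup>2)"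
    and f2: "integrable M (\<lambda>x. (norm (f x))\<^sup>2)" and g2: "integrable M (\<lambda>x. (norm (g x))\<^sup>2)"
    and limF: "(\<lambda>n. \<integral>x. (norm (F n x - f x))\<^sup>2 \<partial>M) \<longlonglongrightarrow> 0"
    and limG: "(\<lambda>n. \<integral>x. (norm (G n x - g x))\<^sup>2 \<partial>M) \<longlonglongrightarrow> 0"
  shows "(\<lambda>n. \<integral>x. mul (F n x) (G n x) \<partial>M) \<longlonglongrightarrow> (\<integral>x. mul (f x) (g x) \<partial>M)"
proof -
  interpret bounded_bilinear mul by fact
  obtain K where K: "K \<ge> 0" "\<And>a b. norm (mul a b) \<le> norm a * norm b * K"
    using nonneg_bounded by blast
  define U where "U n x = F n x - f x" for n x
  define V where "V n x = G n x - g x" for n x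
  define a b where "a = (\<integral>x. (norm (f x))\<^sup>2 \<partial>M)" and "b = (\<integral>x. (norm (g x))\<^sup>2 \<partial>M)"
  define p q where "p n = (\<integral>x. (norm (U n x))\<^sup>2 \<partial>M)" and "q n = (\<integral>x. (norm (V n x))\<^sup>2 \<partial>M)" for n
  have [measurable]: "U n \<in> borel_measurable M" "V n \<in> borel_measurable M" for n
    unfolding U_def V_def by measurable
  have U2: "integrable M (\<lambda>x. (norm (U n x))\<^sup>2)" and V2: "integrable M (\<lambda>x. (norm (V n x))\<^sup>2)" for n
    unfolding U_def V_def using F2 G2 f2 g2 by (auto intro!: integrable_norm_diff_square)
  note CS = integral_Cauchy_Schwarz
  have bound: "norm ((\<integral>x. mul (F n x) (G n x) \<partial>M) - (\<integral>x. mul (f x) (g x) \<partial>M))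
      \<le> (sqrt (p n * q n) + sqrt (p n * b) + sqrt (a * q n)) * K" for n
  proof -
    have int: "integrable M (\<lambda>x. mul (U n x) (V n x))" "integrable M (\<lambda>x. mul (U n x) (g x))"
      "integrable M (\<lambda>x. mul (f x) (V n x))" "integrable M (\<lambda>x. mul (f x) (g x))"
      by (intro integrable_bilinear_L2[OF bil]; simp add: U2 V2 f2 g2)+
    have split: "mul (F n x) (G n x) = mul (U n x) (V n x) + mul (U n x) (g x) + mul (f x) (V n x) + mul (f x) (g x)" for x
      by (simp add: U_def V_def diff_left diff_right)
    have est: "norm (\<integral>x. mul (h x) (k x) \<partial>M) \<le> (\<integral>x. norm (h x) * norm (k x) \<partial>M) * K"
      if [measurable]: "h \<in> borel_measurable M" "k \<in> borel_measurable M"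
        and "integrable M (\<lambda>x. (norm (h x))\<^sup>2)" "integrable M (\<lambda>x. (norm (k x))\<^sup>2)" for h k
    proof -
      have "norm (\<integral>x. mul (h x) (k x) \<partial>M) \<le> (\<integral>x. norm (h x) * norm (k x) * K \<partial>M)"
        using that K(2) by (intro order_trans[OF integral_norm_bound] integral_mono
          integrable_norm integrable_bilinear_L2[OF bil] integrable_mult_left CS(1)) auto
      then show ?thesis by simp
    qed
    have "(\<integral>x. mul (F n x) (G n x) \<partial>M) - (\<integral>x. mul (f x) (g x) \<partial>M)
        = (\<integral>x. mul (U n x) (V n x) \<partial>M) + (\<integral>x. mul (U n x) (g x) \<partial>M) + (\<integral>x. mul (f x) (V n x) \<partial>M)"
      unfolding split using int by simp
    also have "norm \<dots> \<le> norm (\<integral>x. mul (U n x) (V n x) \<partial>M)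
        + norm (\<integral>x. mul (U n x) (g x) \<partial>M) + norm (\<integral>x. mul (f x) (V n x) \<partial>M)"
      by (intro norm_triangle_mono order_refl)
    also have "\<dots> \<le> sqrt (p n * q n) * K + sqrt (p n * b) * K + sqrt (a * q n) * K"
      unfolding p_def q_def a_def b_def using K(1)
      by (intro add_mono order_trans[OF est] mult_right_mono CS(2)) (simp_all add: U2 V2 f2 g2)
    finally show ?thesis by (simp add: algebra_simps)
  qed
  have "p \<longlonglongrightarrow> 0" "q \<longlonglongrightarrow> 0"
    using limF limG by (simp_all add: p_def[abs_def] q_def[abs_def] U_def V_def)
  then have "(\<lambda>n. (sqrt (p n * q n) + sqrt (p n * b) + sqrt (a * q n)) * K)
      \<longlonglongrightarrow> (sqrt (0 * 0) + sqrt (0 * b) + sqrt (a * 0)) * K"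
    by (intro tendsto_intros)
  then have "(\<lambda>n. (\<integral>x. mul (F n x) (G n x) \<partial>M) - (\<integral>x. mul (f x) (g x) \<partial>M)) \<longlonglongrightarrow> 0"
    by (intro Lim_null_comparison[OF always_eventually[OF allI[OF bound]]]) simp
  then show ?thesis by (rule LIM_zero_cancel)
qed

text \<open>
  The expectation is a contraction from \<open>L\<^sup>2\<close> to the target space, so expectations converge; the centred
  difference is the difference \<open>F n - f\<close> minus the difference of the expectations.
\<close>

lemma (in prob_space) centred_tendsto_L2:
  fixes F :: "nat \<Rightarrow> 'a \<Rightarrow> 'b::{banach, second_countable_topology}"
  assumes [measurable]: "\<And>n. F n \<in> borel_measurable M" "f \<in> borel_measurable M"
    and F2: "\<And>n. integrable M (\<lambda>x. (norm (F n x))\<^sup>2)" and f2: "integrable M (\<lambda>x. (norm (f x))\<^sup>2)"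
    and lim: "(\<lambda>n. \<integral>x. (norm (F n x - f x))\<^sup>2 \<partial>M) \<longlonglongrightarrow> 0"
  shows "(\<lambda>n. expectation (F n)) \<longlonglongrightarrow> expectation f"
    and "(\<lambda>n. \<integral>x. (norm ((F n x - expectation (F n)) - (f x - expectation f)))\<^sup>2 \<partial>M) \<longlonglongrightarrow> 0"
proof -
  have D2: "integrable M (\<lambda>x. (norm (F n x - f x))\<^sup>2)" for n
    using F2 f2 by (intro integrable_norm_diff_square) auto
  have int: "integrable M (F n)" "integrable M f" for n
    using norm_expectation_square_le(1)[OF _ F2] norm_expectation_square_le(1)[OF _ f2] by simp_all
  have le: "norm (expectation (F n) - expectation f) \<le> sqrt (\<integral>x. (norm (F n x - f x))\<^sup>2 \<partial>M)" for n
    using norm_expectation_square_le(2)[OF _ D2] int by simp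
  have "(\<lambda>n. sqrt (\<integral>x. (norm (F n x - f x))\<^sup>2 \<partial>M)) \<longlonglongrightarrow> 0"
    using tendsto_real_sqrt[OF lim] by simp
  then have 0: "(\<lambda>n. expectation (F n) - expectation f) \<longlonglongrightarrow> 0"
    by (rule Lim_null_comparison[OF always_eventually[OF allI[OF le]]])
  then show "(\<lambda>n. expectation (F n)) \<longlonglongrightarrow> expectation f"
    by (rule LIM_zero_cancel)
  have bound: "(\<integral>x. (norm ((F n x - expectation (F n)) - (f x - expectation f)))\<^sup>2 \<partial>M)
    \<le> 2 * (\<integral>x. (norm (F n x - f x))\<^sup>2 \<partial>M) + 2 * (norm (expectation (F n) - expectation f))\<^sup>2" for n
  proof -
    have eq: "(F n x - expectation (F n)) - (f x - expectation f)
        = (F n x - f x) - (expectation (F n) - expectation f)" for x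
      by simp
    have "(\<integral>x. (norm ((F n x - expectation (F n)) - (f x - expectation f)))\<^sup>2 \<partial>M)
      \<le> (\<integral>x. 2 * (norm (F n x - f x))\<^sup>2 + 2 * (norm (expectation (F n) - expectation f))\<^sup>2 \<partial>M)"
      unfolding eq using D2 F2 f2
      by (intro integral_mono norm_diff_square_le integrable_norm_diff_square) auto
    then show ?thesis using D2 by (simp add: prob_space)
  qed
  have "(\<lambda>n. 2 * (\<integral>x. (norm (F n x - f x))\<^sup>2 \<partial>M) + 2 * (norm (expectation (F n) - expectation f))\<^sup>2)
      \<longlonglongrightarrow> 2 * 0 + 2 * 0\<^sup>2"
    by (intro tendsto_intros lim tendsto_norm_zero[OF 0])
  then show "(\<lambda>n. \<integral>x. (norm ((F n x - expectation (F n)) - (f x - expectation f)))\<^sup>2 \<partial>M) \<longlonglongrightarrow> 0"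
    by (intro tendsto_sandwich[where f = "\<lambda>_. 0", OF _ always_eventually[OF allI[OF bound]]]) simp_all
qed

section \<open>Gaussian processes as curves in square-integrable functions\<close>

lemma bounded_bilinear_outer_prod:
  "bounded_bilinear (outer_prod :: real ^ 'd \<Rightarrow> real ^ 'd \<Rightarrow> real ^ 'd ^ 'd)"
  unfolding bilinear_conv_bounded_bilinear[symmetric] bilinear_def
  by (auto intro!: linearI simp: outer_prod_def vec_eq_iff algebra_simps)

lemma gaussian_process_linear_combination:
  assumes gp: "gaussian_process M X \<xi>" and I: "finite I" "I \<subseteq> X"
  shows "gaussian_real (distr M borel (\<lambda>\<omega>. \<Sum>i\<in>I. u i \<bullet> \<xi> i \<omega>))"
proof -
  have [measurable]: "\<xi> i \<in> borel_measurable M" if "i \<in> I" for i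
    using gp I that unfolding gaussian_process_def by blast
  have "gaussian_real (distr (fin_dim_distr M \<xi> I) borel (\<lambda>y. \<Sum>i\<in>I. u i \<bullet> y i))"
    using gp I unfolding gaussian_process_def gaussian_PiM_def by blast
  also have "distr (fin_dim_distr M \<xi> I) borel (\<lambda>y. \<Sum>i\<in>I. u i \<bullet> y i)
      = distr M borel (\<lambda>\<omega>. \<Sum>i\<in>I. u i \<bullet> \<xi> i \<omega>)"
    unfolding fin_dim_distr_def
    by (subst distr_distr) (auto simp: o_def intro!: distr_cong sum.cong)
  finally show ?thesis .
qed

lemma norm_square_vec: "(norm v)\<^sup>2 = (\<Sum>i\<in>UNIV. (v $ i)\<^sup>2)" for v :: "real ^ 'd"
  unfolding power2_norm_eq_inner inner_vec_def by (simp add: power2_eq_square)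

lemma borel_measurable_vec_nth [measurable (raw)]:
  fixes f :: "'a \<Rightarrow> real ^ 'd"
  assumes "f \<in> borel_measurable M"
  shows "(\<lambda>x. f x $ i) \<in> borel_measurable M"
  by (rule measurable_compose[OF assms]) (intro borel_measurable_continuous_onI continuous_intros)

lemma gaussian_process_square_integrable:
  fixes \<xi> :: "'x \<Rightarrow> 'w \<Rightarrow> real ^ 'd"
  assumes gp: "gaussian_process M X \<xi>" and x: "x \<in> X"
  shows "integrable M (\<lambda>\<omega>. (norm (\<xi> x \<omega>))\<^sup>2)"
proof -
  have [measurable]: "\<xi> x \<in> borel_measurable M"
    using gp x by (auto simp: gaussian_process_def)
  have "integrable M (\<lambda>\<omega>. (\<xi> x \<omega> $ i)\<^sup>2)" for i
  proof (rule gaussian_real_square_integrable)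
    show "gaussian_real (distr M borel (\<lambda>\<omega>. \<xi> x \<omega> $ i))"
      using gaussian_process_linear_combination[OF gp, of "{x}" "\<lambda>_. axis i 1"] x
      by (simp add: inner_axis')
  qed measurable
  then show ?thesis by (simp add: norm_square_vec)
qed

text \<open>
  Only increments are needed, so the Gaussian hypothesis is used on the index sets \<open>{s n, x}\<close>; the squared
  norm of an increment is the sum of the squares of its components.
\<close>

lemma gaussian_process_L2_continuous:
  fixes \<xi> :: "'x::topological_space \<Rightarrow> 'w \<Rightarrow> real ^ 'd"
  assumes gp: "gaussian_process M X \<xi>"
    and cont: "\<And>\<omega>. \<omega> \<in> space M \<Longrightarrow> continuous_on X (\<lambda>x. \<xi> x \<omega>)"
    and s: "\<And>n. s n \<in> X" and x: "x \<in> X" and lim: "s \<longlonglongrightarrow> x"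
  shows "(\<lambda>n. \<integral>\<omega>. (norm (\<xi> (s n) \<omega> - \<xi> x \<omega>))\<^sup>2 \<partial>M) \<longlonglongrightarrow> 0"
proof -
  have meas[measurable]: "\<xi> y \<in> borel_measurable M" if "y \<in> X" for y
    using gp that by (auto simp: gaussian_process_def)
  note [measurable] = meas[OF s] meas[OF x]
  define Z where "Z i n \<omega> = \<xi> (s n) \<omega> $ i - \<xi> x \<omega> $ i" for i n \<omega>
  have [measurable]: "Z i n \<in> borel_measurable M" for i n
    unfolding Z_def by measurable
  have gauss: "gaussian_real (distr M borel (Z i n))" for i n
  proof -
    \<comment> \<open>A difference of two indicators, so that for \<open>s n = x\<close>, where the index set is a singleton,
      the combination is \<open>0\<close>, as the increment is.\<close>
    define u :: "'x \<Rightarrow> real ^ 'd" where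
      "u y = (if y = s n then axis i 1 else 0) - (if y = x then axis i 1 else 0)" for y
    have "(\<Sum>y\<in>{s n, x}. u y \<bullet> \<xi> y \<omega>) = Z i n \<omega>" for \<omega>
      by (cases "s n = x") (simp_all add: u_def Z_def inner_axis')
    with gaussian_process_linear_combination[OF gp, of "{s n, x}" u] s x show ?thesis
      by (simp add: Z_def[abs_def])
  qed
  have "(\<lambda>n. \<integral>\<omega>. (Z i n \<omega>)\<^sup>2 \<partial>M) \<longlonglongrightarrow> 0" for i
  proof (rule gaussian_real_second_moment_tendsto_zero)
    show "prob_space M" using gp by (simp add: gaussian_process_def)
    show "(\<lambda>n. Z i n \<omega>) \<longlonglongrightarrow> 0" if "\<omega> \<in> space M" for \<omega>
    proof -
      have "(\<lambda>n. \<xi> (s n) \<omega>) \<longlonglongrightarrow> \<xi> x \<omega>"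
        using continuous_on_tendsto_compose[OF cont[OF that] lim x] s by simp
      from tendsto_diff[OF tendsto_vec_nth[OF this, of i] tendsto_const[of "\<xi> x \<omega> $ i"]] show ?thesis
        by (simp add: Z_def)
    qed
  qed (use gauss in auto)
  then have "(\<lambda>n. \<Sum>i\<in>UNIV. \<integral>\<omega>. (Z i n \<omega>)\<^sup>2 \<partial>M) \<longlonglongrightarrow> (\<Sum>i\<in>(UNIV::'d set). 0)"
    by (intro tendsto_sum)
  moreover have "(\<integral>\<omega>. (norm (\<xi> (s n) \<omega> - \<xi> x \<omega>))\<^sup>2 \<partial>M) = (\<Sum>i\<in>UNIV. \<integral>\<omega>. (Z i n \<omega>)\<^sup>2 \<partial>M)" for n
    unfolding norm_square_vec vector_minus_component Z_def[symmetric]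
    by (intro Bochner_Integration.integral_sum gaussian_real_square_integrable gauss) measurable
  ultimately show ?thesis by simp
qed

theorem lemma2p2:
  fixes M :: "'w measure"
    and X :: "'x::metric_space set"
    and \<xi> :: "'x \<Rightarrow> 'w \<Rightarrow> real ^ 'd"
  assumes "compact X"
    and "gaussian_process M X \<xi>"
    and "\<And>\<omega>. \<omega> \<in> space M \<Longrightarrow> continuous_on X (\<lambda>x. \<xi> x \<omega>)"
  shows "continuous_on X (mean_fun M \<xi>) \<and>
         continuous_on (X \<times> X) (\<lambda>(x, y). cov_fun M \<xi> x y)"
proof -
  note gp = assms(2)
  interpret prob_space M using gp by (simp add: gaussian_process_def)
  have meas: "\<xi> x \<in> borel_measurable M" if "x \<in> X" for x
    using gp that by (auto simp: gaussian_process_def)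
  note sq = gaussian_process_square_integrable[OF gp]
  note L2 = gaussian_process_L2_continuous[OF gp assms(3)]
  define \<eta> where "\<eta> x \<omega> = \<xi> x \<omega> - mean_fun M \<xi> x" for x \<omega>
  have mean: "(\<lambda>n. mean_fun M \<xi> (s n)) \<longlonglongrightarrow> mean_fun M \<xi> x"
    and \<eta>_lim: "(\<lambda>n. \<integral>\<omega>. (norm (\<eta> (s n) \<omega> - \<eta> x \<omega>))\<^sup>2 \<partial>M) \<longlonglongrightarrow> 0"
    if "\<And>n. s n \<in> X" "x \<in> X" "s \<longlonglongrightarrow> x" for s x
    using centred_tendsto_L2[of "\<lambda>n. \<xi> (s n)" "\<xi> x"] that meas sq L2[of s x]
    by (simp_all add: \<eta>_def mean_fun_def)
  have \<eta>_meas: "\<eta> x \<in> borel_measurable M" if "x \<in> X" for x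
    unfolding \<eta>_def using meas[OF that] by measurable
  have \<eta>_sq: "integrable M (\<lambda>\<omega>. (norm (\<eta> x \<omega>))\<^sup>2)" if "x \<in> X" for x
    unfolding \<eta>_def using meas[OF that] sq[OF that] by (intro integrable_norm_diff_square) auto
  have cov: "(\<lambda>n. cov_fun M \<xi> (s n) (t n)) \<longlonglongrightarrow> cov_fun M \<xi> x y"
    if "\<And>n. s n \<in> X" "x \<in> X" "s \<longlonglongrightarrow> x" "\<And>n. t n \<in> X" "y \<in> X" "t \<longlonglongrightarrow> y" for s t x y
    unfolding cov_fun_def \<eta>_def[symmetric]
    using that by (intro integral_bilinear_tendsto_L2[OF bounded_bilinear_outer_prod] \<eta>_meas \<eta>_sq \<eta>_lim)
  have "continuous_on X (mean_fun M \<xi>)"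
    unfolding continuous_on_sequentially using mean by (auto simp: o_def)
  moreover have "continuous_on (X \<times> X) (\<lambda>(x, y). cov_fun M \<xi> x y)"
    unfolding continuous_on_sequentially
  proof (intro allI ballI impI, elim conjE)
    fix p :: "nat \<Rightarrow> 'x \<times> 'x" and z assume z: "z \<in> X \<times> X" and p: "\<forall>n. p n \<in> X \<times> X" "p \<longlonglongrightarrow> z"
    from cov[of "\<lambda>n. fst (p n)" "fst z" "\<lambda>n. snd (p n)" "snd z"] z p
    show "((\<lambda>(x, y). cov_fun M \<xi> x y) \<circ> p) \<longlonglongrightarrow> (case z of (x, y) \<Rightarrow> cov_fun M \<xi> x y)"
      by (auto simp: o_def case_prod_beta mem_Times_iff intro: tendsto_fst tendsto_snd)
  qed
  ultimately show ?thesis ..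
qed

end
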